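(* Fix $p\in[0,1]$ and $n\ge4$. Let $\vec G(n,p)$ be the random directed graph on $[n]$ obtained by including each edge independently with probability $p$ and orienting each included edge independently in either direction with probability $1/2$. Let $a,s,b,t$ be distinct vertices. For $t\in T\subseteq[n]$, $a\in A\subseteq[n]$ with $|T|=\tau$, $|A|=\alpha$, $|[n]\setminus(A\cup T)|=r$, let $N_p(n,\tau,\alpha,r)=\mathbb{P}(\overrightarrow{C}_t=T,\ \overleftarrow{C}_a=A)$, where $\overrightarrow{C}_t$ is the set of vertices reachable from $t$ by a directed path and $\overleftarrow{C}_a$ the set of vertices from which $a$ is reachable by a directed path (both containing the vertex itself); this depends only on $n,\tau,\alpha,r$. Then, writing $a\not\to s$ for the event that there is no directed path from $a$ to $s$, $$\begin{aligned}\mathbb{P}(a\not\to s,\ t\not\to b)=&\sum_{j=2}^{n-2}\binom{n-4}{j-2}\Bigg(\sum_{\tau=j}^{n-2}\binom{n-2-j}{\tau-j}\sum_{\alpha=j}^{n-\tau+j-1}\binom{n-\tau-1}{\alpha-j}N_p(n,\tau,\alpha,n-\alpha-\tau+j)\\&\qquad+\sum_{\tau=j+1}^{n-1}\binom{n-2-j}{\tau-j-1}\sum_{\alpha=j}^{n-\tau+j}\binom{n-\tau}{\alpha-j}N_p(n,\tau,\alpha,n-\alpha-\tau+j)\Bigg)\\&+\sum_{\tau=1}^{n-3}\binom{n-4}{\tau-1}\sum_{\alpha=1}^{n-\tau-1}\binom{n-\tau-2}{\alpha-1}N_p(n,\tau,\alpha,n-\alpha-\tau)\\&+\sum_{\t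au=2}^{n-2}\binom{n-4}{\tau-2}\sum_{\alpha=1}^{n-\tau}\binom{n-\tau-1}{\alpha-1}N_p(n,\tau,\alpha,n-\alpha-\tau).\end{aligned}$$
   Context: Probabilities are in the joint space of the random graph and the random orientations.
   Formalization: N_p is taken only over pairs with A∩T empty or containing both a and t; other intersecting pairs have probability 0 (e.g. n=4, T={t,x,y}, A={a,x,y}), so "depends only on n,τ,α,r" fails without this restriction. *)

theory Defs
  imports "HOL-Probability.Probability"
begin

text \<open>The vertex set is [n] = {1..n}; a directed graph on it is its set of arcs. An undirected edge
  {u, v} with u < v is represented by the pair (u, v).\<close>

definition all_edges :: "nat \<Rightarrow> (nat \<times> nat) set" where
  "all_edges n = {(u, v). u \<in> {1..n} \<and> v \<in> {1..n} \<and> u < v}"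

text \<open>The (empty or one-element) set of arcs contributed by a single potential edge.\<close>

definition oriented_edge :: "real \<Rightarrow> nat \<times> nat \<Rightarrow> (nat \<times> nat) set pmf" where
  "oriented_edge p e =
     do {
       included \<leftarrow> bernoulli_pmf p;
       if included
       then do {
         forward \<leftarrow> bernoulli_pmf (1 / 2);
         return_pmf (if forward then {(fst e, snd e)} else {(snd e, fst e)})
       }
       else return_pmf {}
     }"

definition random_digraph :: "nat \<Rightarrow> real \<Rightarrow> (nat \<times> nat) set pmf" where
  "random_digraph n p =
     map_pmf (\<lambda>arcs. \<Union>e\<in>all_edges n. arcs e) (Pi_pmf (all_edges n) {} (oriented_edge p))"

definition out_cluster :: "(nat \<times> nat) set \<Rightarrow> nat \<Rightarrow> nat set" where
  "out_cluster D v = {w. (v, w) \<in> D\<^sup>*}"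

definition in_cluster :: "(nat \<times> nat) set \<Rightarrow> nat \<Rightarrow> nat set" where
  "in_cluster D v = {w. (w, v) \<in> D\<^sup>*}"

definition cluster_prob ::
    "real \<Rightarrow> nat \<Rightarrow> nat \<Rightarrow> nat \<Rightarrow> nat set \<Rightarrow> nat set \<Rightarrow> real" where
  "cluster_prob p n t a T A =
     measure_pmf.prob (random_digraph n p) {D. out_cluster D t = T \<and> in_cluster D a = A}"

text \<open>If the out-cluster T of t meets the in-cluster A of a, then t reaches a through a common
  vertex, so both a and t lie in both clusters. Pairs of sets that intersect but violate this
  have probability zero whatever their sizes, so the probability of a pair (T, A) can be a function
  of the sizes alone only on the pairs that are either disjoint or contain both a and t
  in their intersection.\<close>

lemma clusters_meet:
  assumes "out_cluster D t \<inter> in_cluster D a \<noteq> {}"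
  shows "{a, t} \<subseteq> out_cluster D t \<inter> in_cluster D a"
  using assms by (auto simp: out_cluster_def in_cluster_def intro: rtrancl_trans)

definition cluster_config ::
    "nat \<Rightarrow> nat \<Rightarrow> nat \<Rightarrow> nat \<Rightarrow> nat \<Rightarrow> nat \<Rightarrow> nat set \<Rightarrow> nat set \<Rightarrow> bool" where
  "cluster_config n \<tau> \<alpha> r t a T A \<longleftrightarrow>
     t \<noteq> a \<and> t \<in> T \<and> T \<subseteq> {1..n} \<and> a \<in> A \<and> A \<subseteq> {1..n} \<and>
     card T = \<tau> \<and> card A = \<alpha> \<and> card ({1..n} - (A \<union> T)) = r \<and>
     (A \<inter> T = {} \<or> {a, t} \<subseteq> A \<inter> T)"

text \<open>The common value of the probabilities over all configurations with the given sizes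
  (unspecified if there is none).\<close>

definition N_prob :: "real \<Rightarrow> nat \<Rightarrow> nat \<Rightarrow> nat \<Rightarrow> nat \<Rightarrow> real" where
  "N_prob p n \<tau> \<alpha> r =
     (THE q. \<forall>t a T A. cluster_config n \<tau> \<alpha> r t a T A \<longrightarrow> cluster_prob p n t a T A = q)"

end

theory Submission
  imports Defs "HOL-Combinatorics.Permutations"
begin

text \<open>
  The law of the random digraph is invariant under relabelling the vertices, and two cluster
  configurations of the same sizes differ by a relabelling, so the cluster probabilities depend on
  the sizes alone. Relabelling also exchanges \<open>a\<close> and \<open>s\<close>, which turns the event \<open>a \<not>\<rightarrow> s\<close> into
  \<open>s \<not>\<rightarrow> a\<close>, that is, \<open>s\<close> is not in the in-cluster of \<open>a\<close>; the event \<open>t \<not>\<rightarrow> b\<close> says that \<open>b\<close> is not in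
  the out-cluster of \<open>t\<close>. Summing over the admissible pairs of clusters, according to whether they
  meet (in a set of size \<open>j\<close>) and whether \<open>s\<close> is in the out-cluster of \<open>t\<close>, gives the four sums.
\<close>

section \<open>Invariance of the random digraph under relabelling of the vertices\<close>

text \<open>Direct images commute with unions, so applying \<open>f\<close> to a union of
  independent random sets amounts to applying it to each set, which only renames the index by
  \<open>h\<close>. Because just the union is compared, the families of sets need no reindexing and
  induction on \<open>I\<close> suffices.\<close>

lemma map_image_Union_Pi_pmf:
  fixes f :: "'a \<Rightarrow> 'a" and h :: "'e \<Rightarrow> 'e" and q :: "'e \<Rightarrow> 'a set pmf"
  assumes "finite I" "inj_on h I" "\<And>e. e \<in> I \<Longrightarrow> map_pmf (image f) (q e) = q (h e)"
  shows "map_pmf (\<lambda>arcs. f ` (\<Union>e\<in>I. arcs e)) (Pi_pmf I {} q) =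
         map_pmf (\<lambda>arcs. \<Union>e\<in>h ` I. arcs e) (Pi_pmf (h ` I) {} q)"
  using assms
proof (induction I rule: finite_induct)
  case empty
  then show ?case by simp
next
  case (insert x I)
  have split_insert: "(\<Union>e\<in>insert z J. (g(z := y)) e) = y \<union> (\<Union>e\<in>J. g e)"
    if "z \<notin> J" for z :: 'e and J y and g :: "'e \<Rightarrow> 'a set"
    using that by auto
  have union_insert: "map_pmf (\<lambda>arcs. \<phi> (\<Union>e\<in>insert z J. arcs e)) (Pi_pmf (insert z J) {} q) =
      do {y \<leftarrow> q z; g \<leftarrow> Pi_pmf J {} q; return_pmf (\<phi> (y \<union> (\<Union>e\<in>J. g e)))}"
    if "finite J" "z \<notin> J" for z :: 'e and J and \<phi> :: "'a set \<Rightarrow> 'a set"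
    using that split_insert[OF that(2)]
    by (simp add: Pi_pmf_insert' map_pmf_def bind_assoc_pmf bind_return_pmf del: UN_insert)
  have IH: "map_pmf (\<lambda>arcs. f ` (\<Union>e\<in>I. arcs e)) (Pi_pmf I {} q) =
         map_pmf (\<lambda>arcs. \<Union>e\<in>h ` I. arcs e) (Pi_pmf (h ` I) {} q)"
    using insert.prems by (intro insert.IH) auto
  have "map_pmf (\<lambda>arcs. f ` (\<Union>e\<in>insert x I. arcs e)) (Pi_pmf (insert x I) {} q) =
      do {y \<leftarrow> map_pmf (image f) (q x); S \<leftarrow> map_pmf (\<lambda>arcs. f ` (\<Union>e\<in>I. arcs e)) (Pi_pmf I {} q);
          return_pmf (y \<union> S)}"
    using union_insert[of I x "image f"] insert.hyps
    by (simp add: map_pmf_def bind_assoc_pmf bind_return_pmf image_Un del: UN_insert)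
  also have "\<dots> = do {y \<leftarrow> q (h x); S \<leftarrow> map_pmf (\<lambda>arcs. \<Union>e\<in>h ` I. arcs e) (Pi_pmf (h ` I) {} q);
          return_pmf (y \<union> S)}"
    using insert.prems(2) by (simp only: IH insertI1)
  also have "\<dots> = map_pmf (\<lambda>arcs. \<Union>e\<in>h ` insert x I. arcs e) (Pi_pmf (h ` insert x I) {} q)"
  proof -
    \<comment> \<open>Injectivity makes \<open>h x\<close> a fresh index, so its set is drawn
      independently of the others on the right-hand side too.\<close>
    have "h x \<notin> h ` I" using insert by auto
    from union_insert[OF _ this, of id] insert.hyps show ?thesis
      by (simp add: map_pmf_def bind_assoc_pmf bind_return_pmf del: UN_insert)
  qed
  finally show ?case .
qed

lemma finite_all_edges: "finite (all_edges n)"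
  by (rule finite_subset[of _ "{1..n} \<times> {1..n}"]) (auto simp: all_edges_def)

lemma map_Not_bernoulli_half: "map_pmf Not (bernoulli_pmf (1/2)) = bernoulli_pmf (1/2)"
proof (rule pmf_eqI)
  fix b
  have "inj Not" by (auto simp: inj_def)
  from pmf_map_inj'[OF this, of "bernoulli_pmf (1/2)" "\<not> b"]
  show "pmf (map_pmf Not (bernoulli_pmf (1/2))) b = pmf (bernoulli_pmf (1/2)) b"
    by simp
qed

text \<open>A fair coin is unchanged by negation, so it does not matter which endpoint is listed
  first. A relabelled edge may therefore be rewritten with its smaller endpoint in front.\<close>

lemma oriented_edge_swap: "oriented_edge p (v, u) = oriented_edge p (u, v)"
proof -
  have "map_pmf (\<lambda>b. if b then {(v, u)} else {(u, v)}) (bernoulli_pmf (1/2)) =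
        map_pmf (\<lambda>b. if b then {(v, u)} else {(u, v)}) (map_pmf Not (bernoulli_pmf (1/2)))"
    by (simp only: map_Not_bernoulli_half)
  also have "\<dots> = map_pmf (\<lambda>b. if b then {(u, v)} else {(v, u)}) (bernoulli_pmf (1/2))"
    unfolding pmf.map_comp by (intro map_pmf_cong) auto
  finally show ?thesis
    by (simp add: oriented_edge_def map_pmf_def cong: if_cong)
qed

lemma map_oriented_edge:
  "map_pmf (image (map_prod f f)) (oriented_edge p (u, v)) = oriented_edge p (f u, f v)"
  by (simp add: oriented_edge_def map_bind_pmf if_distrib[of "map_pmf (image (map_prod f f))"]
      if_distrib[of "image (map_prod f f)"] cong: if_cong)

lemma random_digraph_permute:
  assumes "\<pi> permutes {1..n}"
  shows "map_pmf (image (map_prod \<pi> \<pi>)) (random_digraph n p) = random_digraph n p"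
proof -
  \<comment> \<open>\<open>h\<close> is the action of \<open>\<pi>\<close> on undirected edges,
    sorted again because \<open>all_edges\<close> contains increasing pairs only.\<close>
  define h where "h = (\<lambda>(u, v). (min (\<pi> u) (\<pi> v), max (\<pi> u) (\<pi> v)))"
  have \<pi>: "\<pi> u = \<pi> v \<longleftrightarrow> u = v" "\<pi> u \<in> {1..n} \<longleftrightarrow> u \<in> {1..n}" for u v
    using permutes_inj[OF assms] permutes_in_image[OF assms] by (auto dest: injD)
  have inj: "inj_on h (all_edges n)"
    using \<pi>(1) by (auto simp: inj_on_def h_def all_edges_def min_def max_def split: if_splits)
  have into: "h ` all_edges n \<subseteq> all_edges n"
  proof (rule image_subsetI)
    fix e assume "e \<in> all_edges n"
    then show "h e \<in> all_edges n"
      using \<pi>(1)[of "fst e" "snd e"] \<pi>(2)[of "fst e"] \<pi>(2)[of "snd e"]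
      by (auto simp: all_edges_def h_def min_def max_def)
  qed
  have surj: "h ` all_edges n = all_edges n"
    by (rule endo_inj_surj[OF finite_all_edges into inj])
  have "map_pmf (image (map_prod \<pi> \<pi>)) (oriented_edge p e) = oriented_edge p (h e)" for e
  proof (cases e)
    case (Pair u v)
    then show ?thesis
      by (cases "\<pi> u \<le> \<pi> v")
         (simp_all add: map_oriented_edge h_def min_def max_def oriented_edge_swap)
  qed
  with map_image_Union_Pi_pmf[OF finite_all_edges inj, of "map_prod \<pi> \<pi>" "oriented_edge p"] show ?thesis
    by (simp add: random_digraph_def pmf.map_comp o_def surj)
qed

lemma rtrancl_map_prod_iff:
  fixes \<pi> :: "'a \<Rightarrow> 'a"
  assumes "bij \<pi>"
  shows "(\<pi> x, \<pi> y) \<in> (map_prod \<pi> \<pi> ` D)\<^sup>* \<longleftrightarrow> (x, y) \<in> D\<^sup>*"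
proof
  \<comment> \<open>Any map carries paths to paths. The claim is stated for arbitrary
    \<open>f\<close> so that it serves \<open>\<pi>\<close> in one direction and
    \<open>inv \<pi>\<close> in the other.\<close>
  have image: "(f u, f v) \<in> (map_prod f f ` E)\<^sup>*" if "(u, v) \<in> E\<^sup>*"
    for f :: "'a \<Rightarrow> 'a" and E u v
    using that
  proof (induction rule: rtrancl_induct)
    case (step v w)
    then have "(f v, f w) \<in> map_prod f f ` E" by force
    with step.IH show ?case by (rule rtrancl_into_rtrancl)
  qed simp
  show "(\<pi> x, \<pi> y) \<in> (map_prod \<pi> \<pi> ` D)\<^sup>*" if "(x, y) \<in> D\<^sup>*"
    using image[OF that] .
  have "map_prod (inv \<pi>) (inv \<pi>) (map_prod \<pi> \<pi> e) = e" for e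
    using assms by (cases e) (simp add: bij_is_inj)
  then have "map_prod (inv \<pi>) (inv \<pi>) ` map_prod \<pi> \<pi> ` D = D"
    by (simp add: image_image)
  with image[of "\<pi> x" "\<pi> y" "map_prod \<pi> \<pi> ` D" "inv \<pi>"]
  show "(x, y) \<in> D\<^sup>*" if "(\<pi> x, \<pi> y) \<in> (map_prod \<pi> \<pi> ` D)\<^sup>*"
    using that assms by (simp add: bij_is_inj)
qed

lemma cluster_map_prod:
  assumes "bij \<pi>"
  shows "out_cluster (map_prod \<pi> \<pi> ` D) (\<pi> v) = \<pi> ` out_cluster D v"
    and "in_cluster (map_prod \<pi> \<pi> ` D) (\<pi> v) = \<pi> ` in_cluster D v"
proof -
  have "w \<in> \<pi> ` S \<longleftrightarrow> inv \<pi> w \<in> S" "\<pi> (inv \<pi> w) = w" for w S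
    using assms by (auto simp: bij_is_inj bij_is_surj surj_f_inv_f intro!: rev_image_eqI[of "inv \<pi> w"])
  then show "out_cluster (map_prod \<pi> \<pi> ` D) (\<pi> v) = \<pi> ` out_cluster D v"
    and "in_cluster (map_prod \<pi> \<pi> ` D) (\<pi> v) = \<pi> ` in_cluster D v"
    using rtrancl_map_prod_iff[OF assms]
    by (metis (no_types, lifting) mem_Collect_eq out_cluster_def subsetI subset_antisym,
        metis (no_types, lifting) mem_Collect_eq in_cluster_def subsetI subset_antisym)
qed

lemma prob_random_digraph_permute:
  assumes "\<pi> permutes {1..n}"
  shows "measure_pmf.prob (random_digraph n p) {D. P D} =
         measure_pmf.prob (random_digraph n p) {D. P (map_prod \<pi> \<pi> ` D)}"
  using arg_cong[OF random_digraph_permute[OF assms, of p], of "\<lambda>M. measure_pmf.prob M {D. P D}"]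
  by (simp add: vimage_def)

lemma cluster_prob_permute:
  assumes "\<pi> permutes {1..n}"
  shows "cluster_prob p n (\<pi> t) (\<pi> a) (\<pi> ` T) (\<pi> ` A) = cluster_prob p n t a T A"
  unfolding cluster_prob_def
  by (subst prob_random_digraph_permute[OF assms])
     (simp add: cluster_map_prod permutes_bij[OF assms] inj_image_eq_iff permutes_inj[OF assms])

section \<open>Cluster probabilities depend on the sizes alone\<close>

text \<open>Since \<open>|A \<inter> T| = \<tau> + \<alpha> + r - n\<close>, the sizes decide whether the clusters meet and hence fix
  the number of vertices of each colour.\<close>

lemma cluster_config_colours:
  assumes "cluster_config n \<tau> \<alpha> r t a T A"
  shows "image_mset (\<lambda>x. (x \<in> T, x \<in> A, x = t, x = a)) (mset_set {1..n}) =
    {#(True, \<tau> + \<alpha> + r \<noteq> n, True, False), (\<tau> + \<alpha> + r \<noteq> n, True, False, True)#} +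
    replicate_mset (\<tau> + \<alpha> + r - n - 2) (True, True, False, False) +
    replicate_mset (n - \<alpha> - r - of_bool (\<tau> + \<alpha> + r = n)) (True, False, False, False) +
    replicate_mset (n - \<tau> - r - of_bool (\<tau> + \<alpha> + r = n)) (False, True, False, False) +
    replicate_mset r (False, False, False, False)"
proof -
  note conf = assms[unfolded cluster_config_def]
  \<comment> \<open>The colour of a vertex records everything that a configuration says about it.
    Besides \<open>t\<close> and \<open>a\<close>, the vertices fall into four classes of constant
    colour: \<open>I\<close>, \<open>B\<close>, \<open>C\<close> and \<open>R\<close>.\<close>
  let ?c = "\<lambda>x. (x \<in> T, x \<in> A, x = t, x = a)"
  define I where "I = T \<inter> A - {t, a}"
  define B where "B = T - A - {t}"
  define C where "C = A - T - {a}"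
  define R where "R = {1..n} - (A \<union> T)"
  have fin: "finite T" "finite A" using conf by (auto intro: finite_subset)
  then have fins [simp]: "finite I" "finite B" "finite C" "finite R"
    by (auto simp: I_def B_def C_def R_def)
  have un: "{1..n} = {t} \<union> ({a} \<union> (I \<union> (B \<union> (C \<union> R))))"
    using conf by (auto simp: I_def B_def C_def R_def)
  have "mset_set (C \<union> R) = mset_set C + mset_set R"
    by (rule mset_set_Union) (auto simp: C_def R_def fin)
  moreover have "mset_set (B \<union> (C \<union> R)) = mset_set B + mset_set (C \<union> R)"
    by (rule mset_set_Union) (auto simp: B_def C_def R_def fin)
  moreover have "mset_set (I \<union> (B \<union> (C \<union> R))) = mset_set I + mset_set (B \<union> (C \<union> R))"
    by (rule mset_set_Union) (auto simp: I_def B_def C_def R_def fin)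
  moreover have "mset_set ({a} \<union> (I \<union> (B \<union> (C \<union> R)))) = mset_set {a} + mset_set (I \<union> (B \<union> (C \<union> R)))"
    using conf by (intro mset_set_Union) (auto simp: I_def B_def C_def R_def fin)
  moreover have "mset_set ({t} \<union> ({a} \<union> (I \<union> (B \<union> (C \<union> R))))) =
      mset_set {t} + mset_set ({a} \<union> (I \<union> (B \<union> (C \<union> R))))"
    using conf by (intro mset_set_Union) (auto simp: I_def B_def C_def R_def fin)
  ultimately have decomp: "mset_set {1..n} =
      mset_set {t} + (mset_set {a} + (mset_set I + (mset_set B + (mset_set C + mset_set R))))"
    by (simp only: un)
  have img: "image_mset ?c (mset_set S) = replicate_mset (card S) k"
    if "\<And>x. x \<in> S \<Longrightarrow> ?c x = k" "finite S" for S k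
    using that image_mset_cong[of "mset_set S" ?c "\<lambda>_. k"] by (simp add: image_mset_const_eq)
  have "image_mset ?c (mset_set I) = replicate_mset (card I) (True, True, False, False)"
    "image_mset ?c (mset_set B) = replicate_mset (card B) (True, False, False, False)"
    "image_mset ?c (mset_set C) = replicate_mset (card C) (False, True, False, False)"
    "image_mset ?c (mset_set R) = replicate_mset (card R) (False, False, False, False)"
    using conf fins by (intro img; auto simp: I_def B_def C_def R_def)+
  moreover have "card (A \<union> T) + r = n"
    using conf fin card_Diff_subset[of "A \<union> T" "{1..n}"] card_mono[of "{1..n}" "A \<union> T"] by auto
  then have j: "card (T \<inter> A) + n = \<tau> + \<alpha> + r"
    using conf card_Un_Int[OF fin] by (simp add: Un_commute)
  \<comment> \<open>The intersection is empty exactly when the sizes add up to \<open>n\<close>. The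
    last clause of \<open>cluster_config\<close> then decides the colours of \<open>t\<close> and
    \<open>a\<close>: each lies in both sets or in its own only.\<close>
  have inter: "t \<in> A \<longleftrightarrow> \<tau> + \<alpha> + r \<noteq> n" "a \<in> T \<longleftrightarrow> \<tau> + \<alpha> + r \<noteq> n"
    using j conf fin by (auto simp: Int_commute card_eq_0_iff)
  have diff: "card (T - A) = n - \<alpha> - r" "card (A - T) = n - \<tau> - r"
    using conf fin \<open>card (A \<union> T) + r = n\<close>
      card_Diff_subset[of A "A \<union> T"] card_Diff_subset[of T "A \<union> T"]
    by (auto simp: Un_Diff)
  \<comment> \<open>Removing \<open>t\<close> lowers the cardinality only for disjoint clusters;
    otherwise \<open>t\<close> lies in \<open>A\<close> and was not in \<open>T - A\<close> to begin
    with. The same holds for \<open>a\<close> and \<open>C\<close>.\<close>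
  moreover have "card B = n - \<alpha> - r - of_bool (\<tau> + \<alpha> + r = n)"
    using diff conf inter by (simp add: B_def card_Diff_singleton)
  moreover have "card C = n - \<tau> - r - of_bool (\<tau> + \<alpha> + r = n)"
    using diff conf inter by (simp add: C_def card_Diff_singleton)
  \<comment> \<open>For disjoint clusters the right-hand side is 0 by truncated subtraction, which
    is the correct value.\<close>
  moreover have "card I = \<tau> + \<alpha> + r - n - 2"
  proof (cases "A \<inter> T = {}")
    case False
    then have "{t, a} \<subseteq> T \<inter> A" "card {t, a} = 2" using conf by auto
    then show ?thesis using j by (simp add: I_def card_Diff_subset)
  next
    case True
    then have "T \<inter> A = {}" by blast
    then show ?thesis using j by (simp add: I_def)
  qed
  moreover have "card R = r" using conf by (simp add: R_def)
  ultimately show ?thesis using conf inter unfolding decomp by simp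
qed

text \<open>Equal multisets of colours yield a permutation that preserves colours pointwise, and the
  colours determine both roots and both sets.\<close>

lemma cluster_config_orbit:
  assumes "cluster_config n \<tau> \<alpha> r t a T A" "cluster_config n \<tau> \<alpha> r t' a' T' A'"
  obtains \<pi> where "\<pi> permutes {1..n}" "\<pi> t = t'" "\<pi> a = a'" "\<pi> ` T = T'" "\<pi> ` A = A'"
proof -
  have eq: "image_mset (\<lambda>x. (x \<in> T, x \<in> A, x = t, x = a)) (mset_set {1..n}) =
      image_mset (\<lambda>x. (x \<in> T', x \<in> A', x = t', x = a')) (mset_set {1..n})"
    by (simp only: cluster_config_colours[OF assms(1)] cluster_config_colours[OF assms(2)])
  obtain \<pi> where \<pi>: "\<pi> permutes {1..n}"
    and col: "\<forall>x\<in>{1..n}. (x \<in> T, x \<in> A, x = t, x = a) = (\<pi> x \<in> T', \<pi> x \<in> A', \<pi> x = t', \<pi> x = a')"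
    by (rule image_mset_eq_implies_permutes[OF finite_atLeastAtMost eq])
  have set_eq: "\<pi> ` X = Y" if "\<And>x. x \<in> {1..n} \<Longrightarrow> x \<in> X \<longleftrightarrow> \<pi> x \<in> Y" "X \<subseteq> {1..n}" "Y \<subseteq> {1..n}" for X Y
  proof (rule equalityI)
    show "\<pi> ` X \<subseteq> Y" using that(1,2) by auto
    show "Y \<subseteq> \<pi> ` X"
    proof
      fix y assume "y \<in> Y"
      with that(3) permutes_image[OF \<pi>] obtain x where "x \<in> {1..n}" "y = \<pi> x" by (metis imageE subsetD)
      with that(1) \<open>y \<in> Y\<close> show "y \<in> \<pi> ` X" by blast
    qed
  qed
  have sub: "T \<subseteq> {1..n}" "T' \<subseteq> {1..n}" "A \<subseteq> {1..n}" "A' \<subseteq> {1..n}" "t \<in> {1..n}" "a \<in> {1..n}"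
    using assms unfolding cluster_config_def by blast+
  show ?thesis
  proof (rule that[OF \<pi>])
    show "\<pi> t = t'" "\<pi> a = a'"
      using bspec[OF col sub(5)] bspec[OF col sub(6)] by simp_all
    show "\<pi> ` T = T'"
      by (rule set_eq) (use col sub in simp_all)
    show "\<pi> ` A = A'"
      by (rule set_eq) (use col sub in simp_all)
  qed
qed

text \<open>Justifies the definite description in \<open>N_prob\<close>: relabelling makes the
  probability constant over configurations of the given sizes, and the assumed configuration makes
  that constant unique.\<close>

lemma cluster_prob_eq_N_prob:
  assumes "cluster_config n \<tau> \<alpha> r t a T A"
  shows "cluster_prob p n t a T A = N_prob p n \<tau> \<alpha> r"
  unfolding N_prob_def
proof (rule the_equality[symmetric])
  show "\<forall>t' a' T' A'. cluster_config n \<tau> \<alpha> r t' a' T' A' \<longrightarrow>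
      cluster_prob p n t' a' T' A' = cluster_prob p n t a T A"
  proof (intro allI impI)
    fix t' a' T' A' assume "cluster_config n \<tau> \<alpha> r t' a' T' A'"
    then obtain \<pi> where "\<pi> permutes {1..n}" "\<pi> t = t'" "\<pi> a = a'" "\<pi> ` T = T'" "\<pi> ` A = A'"
      by (rule cluster_config_orbit[OF assms])
    then show "cluster_prob p n t' a' T' A' = cluster_prob p n t a T A"
      using cluster_prob_permute by metis
  qed
next
  fix q
  assume "\<forall>t a T A. cluster_config n \<tau> \<alpha> r t a T A \<longrightarrow> cluster_prob p n t a T A = q"
  with assms show "q = cluster_prob p n t a T A" by metis
qed

section \<open>Clusters stay inside the vertex set\<close>

lemma set_pmf_random_digraph:
  assumes "D \<in> set_pmf (random_digraph n p)"
  shows "D \<subseteq> {1..n} \<times> {1..n}"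
proof -
  have sub: "set_pmf (oriented_edge p e) \<subseteq> Pow {(fst e, snd e), (snd e, fst e)}" for e
    by (auto simp: oriented_edge_def split: if_splits)
  obtain arcs where D: "D = (\<Union>e\<in>all_edges n. arcs e)"
    and arcs: "\<And>e. e \<in> all_edges n \<Longrightarrow> arcs e \<in> set_pmf (oriented_edge p e)"
    using assms by (auto simp: random_digraph_def set_Pi_pmf finite_all_edges PiE_dflt_def)
  have "arcs e \<subseteq> {1..n} \<times> {1..n}" if "e \<in> all_edges n" for e
  proof -
    have "arcs e \<subseteq> {(fst e, snd e), (snd e, fst e)}"
      using sub arcs[OF that] by blast
    also have "\<dots> \<subseteq> {1..n} \<times> {1..n}"
      using that by (auto simp: all_edges_def)
    finally show ?thesis .
  qed
  with D show ?thesis by blast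
qed

lemma cluster_subset:
  assumes "D \<subseteq> V \<times> V" "v \<in> V"
  shows "out_cluster D v \<subseteq> V" "in_cluster D v \<subseteq> V"
  using assms by (auto simp: out_cluster_def in_cluster_def elim: rtranclE converse_rtranclE)

section \<open>Sums over intervals of sets, grouped by cardinality\<close>

text \<open>A set between \<open>L\<close> and \<open>U\<close> is \<open>L\<close> together with an
  arbitrary subset of \<open>U - L\<close>, which accounts for the binomial coefficient.\<close>

lemma sum_card_interval:
  fixes f :: "nat \<Rightarrow> 'b :: comm_semiring_1"
  assumes "finite U" "L \<subseteq> U"
  shows "(\<Sum>X | L \<subseteq> X \<and> X \<subseteq> U. f (card X)) =
         (\<Sum>k = card L..card U. of_nat (card U - card L choose (k - card L)) * f k)"
proof -
  let ?S = "{X. L \<subseteq> X \<and> X \<subseteq> U}"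
  have fin: "finite ?S" using assms(1) by simp
  have "(\<Sum>X\<in>?S. f (card X)) = (\<Sum>k = card L..card U. \<Sum>X | X \<in> ?S \<and> card X = k. f (card X))"
  proof (rule sum.group[symmetric])
    show "card ` ?S \<subseteq> {card L..card U}"
    proof (rule image_subsetI)
      fix X assume "X \<in> ?S"
      then have "finite X" "L \<subseteq> X" "X \<subseteq> U" using finite_subset[OF _ assms(1), of X] by simp_all
      then show "card X \<in> {card L..card U}" using assms(1) by (simp add: card_mono)
    qed
  qed (use fin in auto)
  also have "\<dots> = (\<Sum>k = card L..card U. of_nat (card U - card L choose (k - card L)) * f k)"
  proof (intro sum.cong refl)
    fix k assume k: "k \<in> {card L..card U}"
    have finL: "finite L" by (rule finite_subset[OF assms(2,1)])
    have "bij_betw (\<lambda>Y. L \<union> Y) {Y. Y \<subseteq> U - L \<and> card Y = k - card L} {X \<in> ?S. card X = k}"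
    proof (rule bij_betwI[of _ _ _ "\<lambda>X. X - L"])
      show "(\<lambda>Y. L \<union> Y) \<in> {Y. Y \<subseteq> U - L \<and> card Y = k - card L} \<rightarrow> {X \<in> ?S. card X = k}"
      proof (rule Pi_I)
        fix Y assume "Y \<in> {Y. Y \<subseteq> U - L \<and> card Y = k - card L}"
        then have "Y \<subseteq> U - L" and "card Y = k - card L" by auto
        moreover from this have "finite Y" using assms(1) by (intro finite_subset[of Y "U - L"]) auto
        with finL \<open>Y \<subseteq> U - L\<close> have "card (L \<union> Y) = card L + card Y"
          by (intro card_Un_disjoint) auto
        ultimately show "L \<union> Y \<in> {X \<in> ?S. card X = k}"
          using assms k by auto
      qed
    next
      show "(\<lambda>X. X - L) \<in> {X \<in> ?S. card X = k} \<rightarrow> {Y. Y \<subseteq> U - L \<and> card Y = k - card L}"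
        using finL by (auto simp: card_Diff_subset)
    qed auto
    then have "card {X \<in> ?S. card X = k} = card {Y. Y \<subseteq> U - L \<and> card Y = k - card L}"
      by (rule bij_betw_same_card[symmetric])
    also have "\<dots> = (card U - card L choose (k - card L))"
      using assms finL by (simp add: n_subsets card_Diff_subset)
    finally show "(\<Sum>X | X \<in> ?S \<and> card X = k. f (card X)) =
        of_nat (card U - card L choose (k - card L)) * f k" by simp
  qed
  finally show ?thesis .
qed

text \<open>As \<open>I \<subseteq> T\<close>, the range allowed to \<open>A\<close> has a size that
  depends on \<open>T\<close> only through its cardinality, so \<open>sum_card_interval\<close>
  applies to \<open>A\<close> and then to \<open>T\<close>. Taking \<open>M = I\<close> describes
  pairs that meet exactly in \<open>I\<close>; taking \<open>I\<close> empty describes disjoint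
  pairs.\<close>

lemma sum_interval_pairs:
  fixes f :: "nat \<Rightarrow> nat \<Rightarrow> 'b :: comm_semiring_1"
  assumes "finite W" "I \<subseteq> L" "L \<subseteq> U" "U \<subseteq> W" "M \<subseteq> I \<union> (W - U)"
  shows "(\<Sum>T | L \<subseteq> T \<and> T \<subseteq> U. \<Sum>A | M \<subseteq> A \<and> A \<subseteq> I \<union> (W - T). f (card T) (card A)) =
    (\<Sum>\<tau> = card L..card U. of_nat (card U - card L choose (\<tau> - card L)) *
      (\<Sum>\<alpha> = card M..card W - \<tau> + card I.
         of_nat (card W - \<tau> + card I - card M choose (\<alpha> - card M)) * f \<tau> \<alpha>))"
    (is "?lhs = (\<Sum>\<tau> = _.._. _ * ?F \<tau>)")
proof -
  have fin: "finite U" by (rule finite_subset[OF assms(4,1)])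
  have "?lhs = (\<Sum>T | L \<subseteq> T \<and> T \<subseteq> U. ?F (card T))"
  proof (rule sum.cong[OF refl])
    fix T assume "T \<in> {T. L \<subseteq> T \<and> T \<subseteq> U}"
    then have T: "L \<subseteq> T" "T \<subseteq> U" "finite T"
      using finite_subset[OF _ fin, of T] by simp_all
    have finI: "finite I" using assms(2) T(1) by (intro finite_subset[OF _ T(3)]) auto
    have "card (I \<union> (W - T)) = card W - card T + card I"
      using assms T finI by (subst card_Un_disjoint) (auto simp: card_Diff_subset)
    moreover have "finite (I \<union> (W - T))" "M \<subseteq> I \<union> (W - T)" using assms T finI by auto
    ultimately show "(\<Sum>A | M \<subseteq> A \<and> A \<subseteq> I \<union> (W - T). f (card T) (card A)) = ?F (card T)"
      using sum_card_interval[of "I \<union> (W - T)" M "f (card T)"] by simp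
  qed
  also have "\<dots> = (\<Sum>\<tau> = card L..card U. of_nat (card U - card L choose (\<tau> - card L)) * ?F \<tau>)"
    by (rule sum_card_interval) fact+
  finally show ?thesis .
qed

section \<open>The avoidance event as a sum over pairs of clusters\<close>

text \<open>The possible values of the two clusters when \<open>s\<close> does not reach
  \<open>a\<close> and \<open>t\<close> does not reach \<open>b\<close>. The last clause is that of
  \<open>cluster_config\<close>; by \<open>clusters_meet\<close> it discards only pairs of
  probability zero.\<close>

definition avoiding_pairs :: "nat \<Rightarrow> nat \<Rightarrow> nat \<Rightarrow> nat \<Rightarrow> nat \<Rightarrow> (nat set \<times> nat set) set" where
  "avoiding_pairs n a s b t = {(T, A). t \<in> T \<and> T \<subseteq> {1..n} - {b} \<and> a \<in> A \<and> A \<subseteq> {1..n} - {s} \<and>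
     (A \<inter> T = {} \<or> {a, t} \<subseteq> A \<inter> T)}"

lemma finite_avoiding_pairs: "finite (avoiding_pairs n a s b t)"
  by (rule finite_subset[of _ "Pow {1..n} \<times> Pow {1..n}"]) (auto simp: avoiding_pairs_def)

lemma prob_avoiding:
  assumes "a \<in> {1..n}" "t \<in> {1..n}"
  shows "measure_pmf.prob (random_digraph n p) {D. (s, a) \<notin> D\<^sup>* \<and> (t, b) \<notin> D\<^sup>*} =
    (\<Sum>(T, A)\<in>avoiding_pairs n a s b t. cluster_prob p n t a T A)"
proof -
  let ?E = "\<lambda>(T, A). {D. out_cluster D t = T \<and> in_cluster D a = A}"
  have "(s, a) \<notin> D\<^sup>* \<and> (t, b) \<notin> D\<^sup>* \<longleftrightarrow>
      (out_cluster D t, in_cluster D a) \<in> avoiding_pairs n a s b t"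
    if "D \<in> set_pmf (random_digraph n p)" for D
    using cluster_subset[OF set_pmf_random_digraph[OF that]] assms clusters_meet[of D t a]
    by (auto simp: avoiding_pairs_def out_cluster_def in_cluster_def)
  then have "measure_pmf.prob (random_digraph n p) {D. (s, a) \<notin> D\<^sup>* \<and> (t, b) \<notin> D\<^sup>*} =
      measure_pmf.prob (random_digraph n p) (\<Union>TA\<in>avoiding_pairs n a s b t. ?E TA)"
    \<comment> \<open>The two events agree only almost surely, since a digraph outside the support
      could have clusters that leave \<open>{1..n}\<close>.\<close>
    by (intro measure_pmf.finite_measure_eq_AE) (auto simp: AE_measure_pmf_iff)
  also have "\<dots> = (\<Sum>TA\<in>avoiding_pairs n a s b t. measure_pmf.prob (random_digraph n p) (?E TA))"
    by (intro measure_pmf.finite_measure_finite_Union finite_avoiding_pairs)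
       (auto simp: disjoint_family_on_def)
  finally show ?thesis by (simp add: cluster_prob_def case_prod_unfold)
qed

text \<open>Inclusion-exclusion gives the number of vertices outside both clusters. Adding the size
  of the intersection before subtracting keeps the natural subtraction from truncating.\<close>

lemma cluster_prob_avoiding:
  assumes "(T, A) \<in> avoiding_pairs n a s b t" "a \<noteq> t"
  shows "cluster_prob p n t a T A =
    N_prob p n (card T) (card A) (n + card (T \<inter> A) - card A - card T)"
proof (rule cluster_prob_eq_N_prob)
  have sub: "A \<union> T \<subseteq> {1..n}" "finite A" "finite T"
    using assms(1) by (auto simp: avoiding_pairs_def intro: finite_subset)
  have "card ({1..n} - (A \<union> T)) = n - card (A \<union> T)"
    using sub by (simp add: card_Diff_subset)
  also have "\<dots> = n + card (T \<inter> A) - card A - card T"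
    using card_Un_Int[OF sub(2,3)] card_mono[OF sub(2), of "T \<inter> A"] by (simp add: Int_commute)
  finally show "cluster_config n (card T) (card A) (n + card (T \<inter> A) - card A - card T) t a T A"
    using assms by (auto simp: cluster_config_def avoiding_pairs_def)
qed

section \<open>Sums over disjoint and over meeting pairs\<close>

text \<open>The summand takes the size of the intersection as an argument, here always 0, so that
  one function \<open>g\<close> serves disjoint and meeting pairs alike.\<close>

lemma sum_disjoint_pairs:
  fixes g :: "nat \<Rightarrow> nat \<Rightarrow> nat \<Rightarrow> 'b :: comm_semiring_1"
  assumes "finite W" "L \<subseteq> U" "U \<subseteq> W" "M \<subseteq> W - U"
  shows "(\<Sum>(T, A) | L \<subseteq> T \<and> T \<subseteq> U \<and> M \<subseteq> A \<and> A \<subseteq> W - T. g (card (T \<inter> A)) (card T) (card A)) =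
    (\<Sum>\<tau> = card L..card U. of_nat (card U - card L choose (\<tau> - card L)) *
      (\<Sum>\<alpha> = card M..card W - \<tau>. of_nat (card W - \<tau> - card M choose (\<alpha> - card M)) * g 0 \<tau> \<alpha>))"
proof -
  have "(\<Sum>(T, A) | L \<subseteq> T \<and> T \<subseteq> U \<and> M \<subseteq> A \<and> A \<subseteq> W - T. g (card (T \<inter> A)) (card T) (card A)) =
      (\<Sum>(T, A)\<in>(SIGMA T:{T. L \<subseteq> T \<and> T \<subseteq> U}. {A. M \<subseteq> A \<and> A \<subseteq> {} \<union> (W - T)}).
        g 0 (card T) (card A))"
  proof (rule sum.cong, goal_cases)
    case (2 x)
    then have "fst x \<inter> snd x = {}" by auto
    then show ?case by (simp add: case_prod_unfold)
  qed auto
  also have "\<dots> = (\<Sum>T | L \<subseteq> T \<and> T \<subseteq> U. \<Sum>A | M \<subseteq> A \<and> A \<subseteq> {} \<union> (W - T). g 0 (card T) (card A))"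
    using assms finite_subset[OF assms(3,1)] by (intro sum.Sigma[symmetric]) auto
  finally show ?thesis
    using sum_interval_pairs[of W "{}" L U M "g 0"] assms by simp
qed

text \<open>Pairs are sorted by their intersection \<open>I\<close>, which ranges between
  \<open>K\<close> and \<open>H\<close>. Given \<open>I\<close>, the set \<open>T\<close> lies
  between \<open>I \<union> S\<close> and \<open>U\<close>, and \<open>A\<close> is \<open>I\<close>
  plus a part of \<open>W - T\<close>. As \<open>S\<close> is disjoint from \<open>H\<close>, its
  vertices are forced into \<open>T\<close> but not into the intersection, whence the lower bound
  \<open>j + card S\<close>.\<close>

lemma sum_meeting_pairs:
  fixes g :: "nat \<Rightarrow> nat \<Rightarrow> nat \<Rightarrow> 'b :: comm_semiring_1"
  assumes "finite W" "K \<subseteq> H" "H \<union> S \<subseteq> U" "U \<subseteq> W" "H \<inter> S = {}"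
  shows "(\<Sum>(T, A) | S \<subseteq> T \<and> T \<subseteq> U \<and> K \<subseteq> T \<inter> A \<and> T \<inter> A \<subseteq> H \<and> A \<subseteq> W.
      g (card (T \<inter> A)) (card T) (card A)) =
    (\<Sum>j = card K..card H. of_nat (card H - card K choose (j - card K)) *
      (\<Sum>\<tau> = j + card S..card U. of_nat (card U - (j + card S) choose (\<tau> - (j + card S))) *
        (\<Sum>\<alpha> = j..card W - \<tau> + j. of_nat (card W - \<tau> choose (\<alpha> - j)) * g j \<tau> \<alpha>)))"
    (is "?lhs = (\<Sum>j = _.._. _ * ?F j)")
proof -
  have finU: "finite U" and finH: "finite H"
    using assms by (auto intro!: finite_subset[OF _ assms(1)])
  let ?Ts = "\<lambda>I. {T. I \<union> S \<subseteq> T \<and> T \<subseteq> U}" and ?As = "\<lambda>I T. {A. I \<subseteq> A \<and> A \<subseteq> I \<union> (W - T)}"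
  have fin_As: "finite (?As I T)" if "I \<subseteq> H" for I T
  proof -
    have "finite (I \<union> (W - T))" using finite_subset[OF that finH] assms(1) by simp
    then show ?thesis by simp
  qed
  let ?X = "SIGMA I:{I. K \<subseteq> I \<and> I \<subseteq> H}. SIGMA T:?Ts I. ?As I T"
  have "?lhs = (\<Sum>(I, T, A)\<in>?X.
      g (card I) (card T) (card A))"
  \<comment> \<open>Recording the intersection as a first component turns the condition on pairs
    into a dependent product; \<open>snd\<close> forgets it again.\<close>
  proof (rule sum.reindex_bij_witness[of _ snd "\<lambda>(T, A). (T \<inter> A, T, A)"])
    fix x assume "x \<in> {(T, A). S \<subseteq> T \<and> T \<subseteq> U \<and> K \<subseteq> T \<inter> A \<and> T \<inter> A \<subseteq> H \<and> A \<subseteq> W}"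
    then obtain T A where x: "x = (T, A)"
      and TA: "S \<subseteq> T" "T \<subseteq> U" "K \<subseteq> T \<inter> A" "T \<inter> A \<subseteq> H" "A \<subseteq> W" by blast
    show "snd (case x of (T, A) \<Rightarrow> (T \<inter> A, T, A)) = x" by (simp add: x)
    have "T \<in> ?Ts (T \<inter> A)" "A \<in> ?As (T \<inter> A) T" using TA by blast+
    then show "(case x of (T, A) \<Rightarrow> (T \<inter> A, T, A)) \<in> ?X" using TA by (simp add: x)
    show "(case case x of (T, A) \<Rightarrow> (T \<inter> A, T, A) of (I, T, A) \<Rightarrow> g (card I) (card T) (card A)) =
        (case x of (T, A) \<Rightarrow> g (card (T \<inter> A)) (card T) (card A))" by (simp add: x)
  next
    fix x assume "x \<in> ?X"
    then obtain I T A where x: "x = (I, T, A)" and I: "K \<subseteq> I" "I \<subseteq> H"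
      and TA: "I \<union> S \<subseteq> T" "T \<subseteq> U" "I \<subseteq> A" "A \<subseteq> I \<union> (W - T)" by blast
    have meet: "T \<inter> A = I" using TA by blast
    then show "(case snd x of (T, A) \<Rightarrow> (T \<inter> A, T, A)) = x" by (simp add: x)
    have "S \<subseteq> T \<and> T \<subseteq> U \<and> K \<subseteq> T \<inter> A \<and> T \<inter> A \<subseteq> H \<and> A \<subseteq> W"
      unfolding meet using TA I assms(3,4) by blast
    then show "snd x \<in> {(T, A). S \<subseteq> T \<and> T \<subseteq> U \<and> K \<subseteq> T \<inter> A \<and> T \<inter> A \<subseteq> H \<and> A \<subseteq> W}"
      by (simp add: x)
  qed
  also have "\<dots> = (\<Sum>I | K \<subseteq> I \<and> I \<subseteq> H. \<Sum>(T, A)\<in>(SIGMA T:?Ts I. ?As I T). g (card I) (card T) (card A))"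
    using finU finH fin_As by (intro sum.Sigma[symmetric]) auto
  also have "\<dots> = (\<Sum>I | K \<subseteq> I \<and> I \<subseteq> H. \<Sum>T\<in>?Ts I. \<Sum>A\<in>?As I T. g (card I) (card T) (card A))"
    using finU fin_As by (intro sum.cong sum.Sigma[symmetric]) auto
  also have "\<dots> = (\<Sum>I | K \<subseteq> I \<and> I \<subseteq> H. ?F (card I))"
  proof (rule sum.cong[OF refl])
    fix I assume "I \<in> {I. K \<subseteq> I \<and> I \<subseteq> H}"
    then have I: "I \<subseteq> H" by simp
    have "card (I \<union> S) = card I + card S"
      using I assms by (intro card_Un_disjoint) (auto intro: finite_subset[OF _ finH] finite_subset[OF _ finU])
    moreover have "I \<union> S \<subseteq> U" using I assms by auto
    ultimately show "(\<Sum>T\<in>?Ts I. \<Sum>A\<in>?As I T. g (card I) (card T) (card A)) = ?F (card I)"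
      using sum_interval_pairs[of W I "I \<union> S" U I "g (card I)"] assms by simp
  qed
  also have "\<dots> = (\<Sum>j = card K..card H. of_nat (card H - card K choose (j - card K)) * ?F j)"
    by (rule sum_card_interval) fact+
  finally show ?thesis .
qed

text \<open>The first two parts hold the meeting pairs, the last two the disjoint ones; within each
  kind the cases are \<open>s\<close> outside \<open>T\<close> and \<open>s\<close> in
  \<open>T\<close>. When \<open>s\<close> is in \<open>T\<close>, the condition on the intersection
  already keeps it out of \<open>A\<close>, so \<open>A\<close> may range over subsets of
  \<open>{1..n}\<close>. The parts are phrased to fit the two summation lemmas.\<close>

lemma avoiding_pairs_split:
  assumes "a \<noteq> t" "a \<noteq> s" "t \<noteq> s" "b \<noteq> s" "a \<noteq> b"
  shows "avoiding_pairs n a s b t =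
      {(T, A). {} \<subseteq> T \<and> T \<subseteq> {1..n} - {b, s} \<and> {a, t} \<subseteq> T \<inter> A \<and>
        T \<inter> A \<subseteq> {1..n} - {b, s} \<and> A \<subseteq> {1..n} - {s}}
    \<union> {(T, A). {s} \<subseteq> T \<and> T \<subseteq> {1..n} - {b} \<and> {a, t} \<subseteq> T \<inter> A \<and>
        T \<inter> A \<subseteq> {1..n} - {b, s} \<and> A \<subseteq> {1..n}}
    \<union> {(T, A). {t} \<subseteq> T \<and> T \<subseteq> {1..n} - {a, b, s} \<and> {a} \<subseteq> A \<and> A \<subseteq> ({1..n} - {s}) - T}
    \<union> {(T, A). {s, t} \<subseteq> T \<and> T \<subseteq> {1..n} - {a, b} \<and> {a} \<subseteq> A \<and> A \<subseteq> {1..n} - T}"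
    (is "?Q = ?Q1 \<union> ?Q2 \<union> ?Q3 \<union> ?Q4")
proof -
  have "x \<in> ?Q \<longleftrightarrow> x \<in> ?Q1 \<union> ?Q2 \<union> ?Q3 \<union> ?Q4" for x
  proof (cases x)
    case (Pair T A)
    \<comment> \<open>With disjointness treated as an atom, what remains is propositional logic in
      the memberships of \<open>a\<close>, \<open>s\<close>, \<open>b\<close>, \<open>t\<close> and
      a few inclusions.\<close>
    define P where "P \<longleftrightarrow> A \<inter> T = {}"
    have P: "P \<longrightarrow> \<not> (v \<in> A \<and> v \<in> T)" for v unfolding P_def by blast
    have disj: "A \<subseteq> X - T \<longleftrightarrow> A \<subseteq> X \<and> P" for X unfolding P_def by blast
    have mono: "T \<subseteq> X \<longrightarrow> T \<inter> A \<subseteq> X" for X by blast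
    show ?thesis
      unfolding Pair avoiding_pairs_def
      using assms P[of a] P[of t] P[of s] mono[of "{1..n}"]
      by (simp only: P_def[symmetric] Un_iff mem_Collect_eq prod.case disj subset_Diff_insert Diff_empty
          insert_subset empty_subsetI Int_iff insert_iff empty_iff simp_thms) argo
  qed
  then show ?thesis by (rule set_eqI)
qed

section \<open>Evaluation of the four sums\<close>

theorem theorem5p3:
  fixes p :: real and n a s b t :: nat
  assumes "0 \<le> p" and "p \<le> 1" and "n \<ge> 4"
    and "{a, s, b, t} \<subseteq> {1..n}" and "distinct [a, s, b, t]"
  shows "(\<forall>\<tau> \<alpha> r t' a' T A. cluster_config n \<tau> \<alpha> r t' a' T A \<longrightarrow>
            measure_pmf.prob (random_digraph n p)
              {D. out_cluster D t' = T \<and> in_cluster D a' = A} = N_prob p n \<tau> \<alpha> r)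
    \<and> measure_pmf.prob (random_digraph n p) {D. (a, s) \<notin> D\<^sup>* \<and> (t, b) \<notin> D\<^sup>*} =
      (\<Sum>j = 2..n - 2. real (n - 4 choose (j - 2)) *
         ((\<Sum>\<tau> = j..n - 2. real (n - 2 - j choose (\<tau> - j)) *
             (\<Sum>\<alpha> = j..n - \<tau> + j - 1. real (n - \<tau> - 1 choose (\<alpha> - j)) *
                N_prob p n \<tau> \<alpha> (n + j - \<alpha> - \<tau>)))
          + (\<Sum>\<tau> = j + 1..n - 1. real (n - 2 - j choose (\<tau> - j - 1)) *
             (\<Sum>\<alpha> = j..n - \<tau> + j. real (n - \<tau> choose (\<alpha> - j)) *
                N_prob p n \<tau> \<alpha> (n + j - \<alpha> - \<tau>)))))
      + (\<Sum>\<tau> = 1..n - 3. real (n - 4 choose (\<tau> - 1)) *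
           (\<Sum>\<alpha> = 1..n - \<tau> - 1. real (n - \<tau> - 2 choose (\<alpha> - 1)) *
              N_prob p n \<tau> \<alpha> (n - \<alpha> - \<tau>)))
      + (\<Sum>\<tau> = 2..n - 2. real (n - 4 choose (\<tau> - 2)) *
           (\<Sum>\<alpha> = 1..n - \<tau>. real (n - \<tau> - 1 choose (\<alpha> - 1)) *
              N_prob p n \<tau> \<alpha> (n - \<alpha> - \<tau>)))"
proof (intro conjI allI impI)
  show "measure_pmf.prob (random_digraph n p) {D. out_cluster D t' = T \<and> in_cluster D a' = A} =
      N_prob p n \<tau> \<alpha> r" if "cluster_config n \<tau> \<alpha> r t' a' T A" for \<tau> \<alpha> r t' a' T A
    using cluster_prob_eq_N_prob[OF that] by (simp add: cluster_prob_def)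
next
  let ?V = "{1..n}"
  define g where "g = (\<lambda>j \<tau> \<alpha>. N_prob p n \<tau> \<alpha> (n + j - \<alpha> - \<tau>))"
  let ?g = "\<lambda>(T, A). g (card (T \<inter> A)) (card T) (card A)"
  let ?Q1 = "{(T, A). {} \<subseteq> T \<and> T \<subseteq> ?V - {b, s} \<and> {a, t} \<subseteq> T \<inter> A \<and>
        T \<inter> A \<subseteq> ?V - {b, s} \<and> A \<subseteq> ?V - {s}}"
  let ?Q2 = "{(T, A). {s} \<subseteq> T \<and> T \<subseteq> ?V - {b} \<and> {a, t} \<subseteq> T \<inter> A \<and>
        T \<inter> A \<subseteq> ?V - {b, s} \<and> A \<subseteq> ?V}"
  let ?Q3 = "{(T, A). {t} \<subseteq> T \<and> T \<subseteq> ?V - {a, b, s} \<and> {a} \<subseteq> A \<and> A \<subseteq> (?V - {s}) - T}"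
  let ?Q4 = "{(T, A). {s, t} \<subseteq> T \<and> T \<subseteq> ?V - {a, b} \<and> {a} \<subseteq> A \<and> A \<subseteq> ?V - T}"
  have dist: "a \<noteq> s" "a \<noteq> b" "a \<noteq> t" "s \<noteq> b" "s \<noteq> t" "b \<noteq> t"
    "a \<in> ?V" "s \<in> ?V" "b \<in> ?V" "t \<in> ?V"
    using assms by auto
  have split: "avoiding_pairs n a s b t = ?Q1 \<union> ?Q2 \<union> ?Q3 \<union> ?Q4"
    by (rule avoiding_pairs_split) (use dist in auto)
  have fin: "finite ?Q1" "finite ?Q2" "finite ?Q3" "finite ?Q4"
    using finite_avoiding_pairs[of n a s b t] unfolding split by simp_all
  have cards: "card {} = 0" "card {a} = 1" "card {t} = 1" "card {s} = 1" "card {a, t} = 2"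
    "card {s, t} = 2" "card ?V = n" "card (?V - {s}) = n - 1" "card (?V - {b}) = n - 1"
    "card (?V - {b, s}) = n - 2"
    "card (?V - {a, b}) = n - 2" "card (?V - {a, b, s}) = n - 3"
    using dist by (auto simp: card_Diff_subset)
  have arith: "n - 2 - 2 = n - 4" "n - 3 - 1 = n - 4" "n - 1 - j - 1 = n - 2 - j"
    "j - (\<tau> + 1) = j - \<tau> - 1" "n - 1 - \<tau> = n - \<tau> - 1" "n - \<tau> - 1 - 1 = n - \<tau> - 2" for j \<tau>
    by simp_all
  have q1: "sum ?g ?Q1 = (\<Sum>j = 2..n - 2. real (n - 4 choose (j - 2)) *
      (\<Sum>\<tau> = j..n - 2. real (n - 2 - j choose (\<tau> - j)) *
        (\<Sum>\<alpha> = j..n - \<tau> + j - 1. real (n - \<tau> - 1 choose (\<alpha> - j)) * g j \<tau> \<alpha>)))"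
  proof -
    \<comment> \<open>The two upper limits agree despite truncated subtraction because
      \<open>\<tau> \<le> n - 2\<close> leaves \<open>n - \<tau>\<close> positive.\<close>
    have eq: "(\<Sum>\<alpha> = j..n - \<tau> - 1 + j. real (n - \<tau> - 1 choose (\<alpha> - j)) * g j \<tau> \<alpha>) =
        (\<Sum>\<alpha> = j..n - \<tau> + j - 1. real (n - \<tau> - 1 choose (\<alpha> - j)) * g j \<tau> \<alpha>)"
      if "\<tau> \<in> {j..n - 2}" for j \<tau>
    proof -
      have "n - \<tau> - 1 + j = n - \<tau> + j - 1"
        using that assms(3) by auto
      then show ?thesis by (simp only:)
    qed
    \<comment> \<open>Here \<open>s\<close> is in neither cluster: \<open>A\<close> ranges inside
      \<open>?V - {s}\<close>, and no vertex beyond the intersection is forced into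
      \<open>T\<close>.\<close>
    have pre: "finite (?V - {s})" "{a, t} \<subseteq> ?V - {b, s}" "?V - {b, s} \<union> {} \<subseteq> ?V - {b, s}"
      "?V - {b, s} \<subseteq> ?V - {s}" "(?V - {b, s}) \<inter> {} = {}"
      using dist by auto
    have "sum ?g ?Q1 = (\<Sum>j = 2..n - 2. real (n - 4 choose (j - 2)) *
      (\<Sum>\<tau> = j..n - 2. real (n - 2 - j choose (\<tau> - j)) *
        (\<Sum>\<alpha> = j..n - \<tau> - 1 + j. real (n - \<tau> - 1 choose (\<alpha> - j)) * g j \<tau> \<alpha>)))"
      using sum_meeting_pairs[of "?V - {s}" "{a, t}" "?V - {b, s}" "{}" "?V - {b, s}" g, OF pre]
      by (simp only: cards arith(1,2,5,6) add_0_right)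
    also have "\<dots> = (\<Sum>j = 2..n - 2. real (n - 4 choose (j - 2)) *
      (\<Sum>\<tau> = j..n - 2. real (n - 2 - j choose (\<tau> - j)) *
        (\<Sum>\<alpha> = j..n - \<tau> + j - 1. real (n - \<tau> - 1 choose (\<alpha> - j)) * g j \<tau> \<alpha>)))"
      by (intro eq sum.cong refl arg_cong2[where f = "(*)"])
    finally show ?thesis .
  qed
  have q2: "sum ?g ?Q2 = (\<Sum>j = 2..n - 2. real (n - 4 choose (j - 2)) *
      (\<Sum>\<tau> = j + 1..n - 1. real (n - 2 - j choose (\<tau> - j - 1)) *
        (\<Sum>\<alpha> = j..n - \<tau> + j. real (n - \<tau> choose (\<alpha> - j)) * g j \<tau> \<alpha>)))"
  proof -
    \<comment> \<open>Now \<open>S = {s}\<close> is forced into \<open>T\<close>, which shifts the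
      range of \<open>\<tau>\<close> by one.\<close>
    have pre: "finite ?V" "{a, t} \<subseteq> ?V - {b, s}" "?V - {b, s} \<union> {s} \<subseteq> ?V - {b}"
      "?V - {b} \<subseteq> ?V" "(?V - {b, s}) \<inter> {s} = {}"
      using dist by auto
    show ?thesis
      using sum_meeting_pairs[of ?V "{a, t}" "?V - {b, s}" "{s}" "?V - {b}" g, OF pre]
      by (simp only: cards arith(1,3,4))
  qed
  have q3: "sum ?g ?Q3 = (\<Sum>\<tau> = 1..n - 3. real (n - 4 choose (\<tau> - 1)) *
      (\<Sum>\<alpha> = 1..n - \<tau> - 1. real (n - \<tau> - 2 choose (\<alpha> - 1)) * g 0 \<tau> \<alpha>))"
  proof -
    have pre: "finite (?V - {s})" "{t} \<subseteq> ?V - {a, b, s}" "?V - {a, b, s} \<subseteq> ?V - {s}"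
      "{a} \<subseteq> (?V - {s}) - (?V - {a, b, s})"
      using dist by auto
    show ?thesis
      using sum_disjoint_pairs[of "?V - {s}" "{t}" "?V - {a, b, s}" "{a}" g, OF pre]
      by (simp only: cards arith(1,2,5,6))
  qed
  have q4: "sum ?g ?Q4 = (\<Sum>\<tau> = 2..n - 2. real (n - 4 choose (\<tau> - 2)) *
      (\<Sum>\<alpha> = 1..n - \<tau>. real (n - \<tau> - 1 choose (\<alpha> - 1)) * g 0 \<tau> \<alpha>))"
  proof -
    have pre: "finite ?V" "{s, t} \<subseteq> ?V - {a, b}" "?V - {a, b} \<subseteq> ?V" "{a} \<subseteq> ?V - (?V - {a, b})"
      using dist by auto
    show ?thesis
      using sum_disjoint_pairs[of ?V "{s, t}" "?V - {a, b}" "{a}" g, OF pre]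
      by (simp only: cards arith(1,2,5,6))
  qed
  \<comment> \<open>This relabelling fixes \<open>t\<close> and \<open>b\<close>, so only the first
    half of the event changes.\<close>
  have "Transposition.transpose a s permutes ?V"
    using dist by (intro permutes_swap_id)
  then have "measure_pmf.prob (random_digraph n p) {D. (a, s) \<notin> D\<^sup>* \<and> (t, b) \<notin> D\<^sup>*} =
      measure_pmf.prob (random_digraph n p) {D. (s, a) \<notin> D\<^sup>* \<and> (t, b) \<notin> D\<^sup>*}"
    using rtrancl_map_prod_iff[of "Transposition.transpose a s" s a]
      rtrancl_map_prod_iff[of "Transposition.transpose a s" t b] dist
    by (subst prob_random_digraph_permute) auto
  also have "\<dots> = (\<Sum>(T, A)\<in>avoiding_pairs n a s b t. cluster_prob p n t a T A)"
    using dist by (intro prob_avoiding)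
  also have "\<dots> = sum ?g (avoiding_pairs n a s b t)"
    using dist by (intro sum.cong refl) (auto simp: cluster_prob_avoiding g_def)
  also have "\<dots> = sum ?g ?Q1 + sum ?g ?Q2 + sum ?g ?Q3 + sum ?g ?Q4"
  proof -
    \<comment> \<open>Whether \<open>a\<close> lies in \<open>T\<close> separates meeting from
      disjoint pairs, and whether \<open>s\<close> does separates the two cases of each
      kind.\<close>
    have "?Q1 \<inter> ?Q2 = {}" "(?Q1 \<union> ?Q2) \<inter> ?Q3 = {}" "(?Q1 \<union> ?Q2 \<union> ?Q3) \<inter> ?Q4 = {}"
      by auto
    then show ?thesis
      unfolding split using fin by (simp only: sum.union_disjoint finite_UnI)
  qed
  finally show "measure_pmf.prob (random_digraph n p) {D. (a, s) \<notin> D\<^sup>* \<and> (t, b) \<notin> D\<^sup>*} =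
      (\<Sum>j = 2..n - 2. real (n - 4 choose (j - 2)) *
         ((\<Sum>\<tau> = j..n - 2. real (n - 2 - j choose (\<tau> - j)) *
             (\<Sum>\<alpha> = j..n - \<tau> + j - 1. real (n - \<tau> - 1 choose (\<alpha> - j)) *
                N_prob p n \<tau> \<alpha> (n + j - \<alpha> - \<tau>)))
          + (\<Sum>\<tau> = j + 1..n - 1. real (n - 2 - j choose (\<tau> - j - 1)) *
             (\<Sum>\<alpha> = j..n - \<tau> + j. real (n - \<tau> choose (\<alpha> - j)) *
                N_prob p n \<tau> \<alpha> (n + j - \<alpha> - \<tau>)))))
      + (\<Sum>\<tau> = 1..n - 3. real (n - 4 choose (\<tau> - 1)) *
           (\<Sum>\<alpha> = 1..n - \<tau> - 1. real (n - \<tau> - 2 choose (\<alpha> - 1)) *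
              N_prob p n \<tau> \<alpha> (n - \<alpha> - \<tau>)))
      + (\<Sum>\<tau> = 2..n - 2. real (n - 4 choose (\<tau> - 2)) *
           (\<Sum>\<alpha> = 1..n - \<tau>. real (n - \<tau> - 1 choose (\<alpha> - 1)) *
              N_prob p n \<tau> \<alpha> (n - \<alpha> - \<tau>)))"
    by (simp only: q1 q2 q3 q4) (simp add: g_def sum.distrib distrib_left)
qed

end
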